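(* Let $p\in[1,+\infty)$ and let $(\varphi_n)$ be a bounded sequence in $L^p(\mathbb{R}_+)$ of non-negative functions such that $$\exists\,\mu>0,\qquad\limsup_{n\to+\infty}\;x_\mu(\varphi_n)\;<\;+\infty.$$ Then there exists a non-negative measurable function $\psi$ on $\mathbb{R}_+$ such that, up to extraction of a subsequence, for almost every $\nu>0$, $$\mathrm{meas}\big(\{\varphi_n^\natural\geq\nu\}\triangle\{\psi\geq\nu\}\big)\;\xrightarrow[n\to+\infty]{}\;0,$$ where $\varphi_n^\natural$ is the tamping of $\varphi_n$.
   Context: $\mathbb{R}_+=[0,+\infty)$, $\mathrm{meas}$ is Lebesgue measure, $A\triangle B=(A\cup B)\setminus(A\cap B)$, $\mathfrak{M}_+(\mathbb{R}_+)$ is the set of non-negative measurable functions on $\mathbb{R}_+$ (identified when equal a.e.), and $\{\varphi\ge\nu\}=\{x\in\mathbb{R}_+:\varphi(x)\ge\nu\}$. Hollows. For $A\subseteq\mathbb{R}_+$ measurable, the essential convex hull is $\mathrm{conv\,ess}\,A:=\bigcap_{\mathrm{meas}(A\triangle B)=0}\mathrm{conv}\,B$. The hollows of $A$ are $\mathcal{H}(A):=(\mathrm{conv\,ess}\,A)\setminus A$ (understood up to null sets). For $\varphi\in\mathfrak{M}_+(\mathbb{R}_+)$ and $\nu\in(0,+\infty]$, $\mathcal{H}_\nu(\varphi):=\bigcup_{\lambda<\nu}\mathcal{H}(\{\varphi\ge\lambda\})$. Tamping. For $\nu>0$ let $x_\nu(\varphi):=\mathrm{inf\,ess}\{\varphi\ge\nu\}\in[0,+\infty]$,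 where $\mathrm{inf\,ess}\,A:=\sup\{a\ge0:\mathrm{meas}(A\cap[0,a])=0\}$ (so $x_\nu(\varphi)=+\infty$ if $\{\varphi\ge\nu\}$ is null), and, when $\mathrm{meas}\{\varphi\ge\nu\}>0$, $y_\nu(\varphi):=x_\nu(\varphi)-\mathrm{meas}(\mathcal{H}_\infty(\varphi)\cap[0,x_\nu(\varphi)])$. Put $S_\nu(\varphi):=[\,y_\nu(\varphi),\,y_\nu(\varphi)+\mathrm{meas}\{\varphi\ge\nu\}\,]$ (meaning $\emptyset$ if $\mathrm{meas}\{\varphi\ge\nu\}=0$, and $[y_\nu(\varphi),+\infty)$ if it is $+\infty$). These sets are non-increasing in $\nu$. The tamping $\varphi^\natural$ of $\varphi$ is the function whose superlevel sets $\{\varphi^\natural\ge\nu\}$ are the $S_\nu(\varphi)$; explicitly $\varphi^\natural(x):=\sup\{\nu>0: x\in S_\nu(\varphi)\}$ with $\sup\emptyset=0$ (for almost every $\nu$, $\{\varphi^\natural\ge\nu\}=S_\nu(\varphi)$ up to a null set). *)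

theory Defs
  imports "HOL-Analysis.Analysis"
begin

text \<open>
  Functions on the half-line are modelled as functions on the reals of which only the values on
  \<open>{0..}\<close> matter. They take values in \<open>ennreal\<close>, since a tamping can be infinite
  at a point. Lebesgue measure is \<open>emeasure lebesgue\<close>; as this is 0 on non-measurable sets,
  the definitions are meant for measurable sets and functions only.
\<close>

definition superlevel :: "(real \<Rightarrow> ennreal) \<Rightarrow> ennreal \<Rightarrow> real set" where
  "superlevel \<phi> \<nu> = {x. 0 \<le> x \<and> \<nu> \<le> \<phi> x}"

definition conv_ess :: "real set \<Rightarrow> real set" where
  "conv_ess A = \<Inter> {convex hull B | B.
     B \<subseteq> {0..} \<and> B \<in> sets lebesgue \<and> emeasure lebesgue (sym_diff A B) = 0}"

definition hollows :: "real set \<Rightarrow> real set" where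
  "hollows A = conv_ess A - A"

text \<open>
  The union below is uncountable, but for a measurable representative it reduces to the union over
  rational \<open>\<kappa>\<close>, and changing \<open>\<phi>\<close> on a null set changes it only inside that null set. The
  level \<open>\<kappa> = 0\<close> contributes nothing.
\<close>

definition hollows_below :: "ennreal \<Rightarrow> (real \<Rightarrow> ennreal) \<Rightarrow> real set" where
  "hollows_below \<nu> \<phi> = (\<Union>\<kappa>\<in>{..<\<nu>}. hollows (superlevel \<phi> \<kappa>))"

definition inf_ess :: "real set \<Rightarrow> ennreal" where
  "inf_ess A = (SUP a\<in>{a. 0 \<le> a \<and> emeasure lebesgue (A \<inter> {0..a}) = 0}. ennreal a)"

definition x_level :: "ennreal \<Rightarrow> (real \<Rightarrow> ennreal) \<Rightarrow> ennreal" where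
  "x_level \<nu> \<phi> = inf_ess (superlevel \<phi> \<nu>)"

text \<open>
  Only meaningful when the superlevel set has positive measure; then \<open>x_level \<nu> \<phi>\<close> is
  finite and the (truncated) subtraction is a genuine one.
\<close>

definition y_level :: "ennreal \<Rightarrow> (real \<Rightarrow> ennreal) \<Rightarrow> ennreal" where
  "y_level \<nu> \<phi> = x_level \<nu> \<phi> -
     emeasure lebesgue (hollows_below \<infinity> \<phi> \<inter> {x. 0 \<le> x \<and> ennreal x \<le> x_level \<nu> \<phi>})"

definition tamped_level :: "ennreal \<Rightarrow> (real \<Rightarrow> ennreal) \<Rightarrow> real set" where
  "tamped_level \<nu> \<phi> =
     (if emeasure lebesgue (superlevel \<phi> \<nu>) = 0 then {}
      else {x. 0 \<le> x \<and> y_level \<nu> \<phi> \<le> ennreal x \<and>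
               ennreal x \<le> y_level \<nu> \<phi> + emeasure lebesgue (superlevel \<phi> \<nu>)})"

definition tamping :: "(real \<Rightarrow> ennreal) \<Rightarrow> real \<Rightarrow> ennreal" where
  "tamping \<phi> x = Sup {\<nu>. 0 < \<nu> \<and> \<nu> < \<infinity> \<and> x \<in> tamped_level \<nu> \<phi>}"

definition in_Lp :: "real \<Rightarrow> (real \<Rightarrow> real) \<Rightarrow> bool" where
  "in_Lp p f \<longleftrightarrow> f \<in> borel_measurable (lebesgue_on {0..}) \<and>
     integrable (lebesgue_on {0..}) (\<lambda>x. \<bar>f x\<bar> powr p)"

definition Lp_norm :: "real \<Rightarrow> (real \<Rightarrow> real) \<Rightarrow> real" where
  "Lp_norm p f = (integral\<^sup>L (lebesgue_on {0..}) (\<lambda>x. \<bar>f x\<bar> powr p)) powr (1 / p)"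

end

theory Submission
  imports Defs "HOL-Complex_Analysis.Great_Picard"
begin

text \<open>
  The superlevel sets of a tamping are the nested intervals \<open>[y_level \<nu> \<phi>, y_level \<nu> \<phi> + |{\<phi> \<ge> \<nu>}|]\<close>.
  Nestedness holds because \<open>y_level \<nu> \<phi>\<close> is the measure of \<open>[0, x_level \<nu> \<phi>]\<close> minus the hollows, so
  that it increases with \<open>\<nu>\<close>, by at most the decrease of \<open>|{\<phi> \<ge> \<nu>}|\<close>. The bound on \<open>x_level\<close> at a
  single level together with Chebyshev's inequality bounds both endpoints at every level, so by
  Helly's selection theorem they converge along a subsequence at all but countably many levels.
  The limit intervals are again nested and shrink to length 0 as \<open>\<nu> \<rightarrow> \<infinity>\<close>, hence are the superlevel
  sets of an almost everywhere finite function.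
\<close>

section \<open>Helly's selection theorem for monotone functions\<close>

text \<open>A subsequence converges at every rational point of \<open>S\<close>, and the limit there
  extends to a monotone \<open>F\<close>. Near a continuity point \<open>x\<close>, the values of
  \<open>F\<close> at rationals on either side are close to \<open>F x\<close>, and monotonicity
  traps \<open>f (r n) x\<close> between the values of \<open>f (r n)\<close> at these rationals.
  The bound \<open>K\<close> may vary with the point, as is needed for endpoints of levels that grow
  without bound near level 0.\<close>

lemma helly_selection_mono_on:
  fixes f :: "nat \<Rightarrow> real \<Rightarrow> real" and S :: "real set"
  assumes S: "open S"
    and mono: "\<And>n. mono_on S (f n)"
    and bd: "\<And>n x. x \<in> S \<Longrightarrow> \<bar>f n x\<bar> \<le> K x"
  obtains r F where "strict_mono (r :: nat \<Rightarrow> nat)" "mono_on S F"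
    "\<And>x. x \<in> S \<Longrightarrow> isCont F x \<Longrightarrow> (\<lambda>n. f (r n) x) \<longlonglongrightarrow> F x"
proof -
  define Q where "Q = S \<inter> \<rat>"
  have K0: "0 \<le> K x" if "x \<in> S" for x
    using bd[OF that, of 0] by linarith
  have Q: "countable Q"
    unfolding Q_def using countable_rat by (metis countable_Int2)
  \<comment> \<open>Dividing by \<open>1 + K x\<close> makes the pointwise bound uniform, as
    \<open>function_convergent_subsequence\<close> requires. The factor is constant in
    \<open>n\<close>, so it is multiplied back afterwards.\<close>
  have bdg: "norm (f n x / (1 + K x)) \<le> 1" if "x \<in> Q" for n x
    using bd[of x n] K0[of x] that by (auto simp: Q_def)
  obtain r where r: "strict_mono (r :: nat \<Rightarrow> nat)"
    and lim: "\<And>x. x \<in> Q \<Longrightarrow> \<exists>l. (\<lambda>n. f (r n) x / (1 + K x)) \<longlonglongrightarrow> l"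
    using function_convergent_subsequence[of Q "\<lambda>n x. f n x / (1 + K x)" 1, OF Q bdg] by blast
  have "\<exists>l. (\<lambda>n. f (r n) x) \<longlonglongrightarrow> l" if x: "x \<in> Q" for x
  proof -
    obtain l where "(\<lambda>n. f (r n) x / (1 + K x)) \<longlonglongrightarrow> l"
      using lim[OF x] by blast
    from tendsto_mult_right[OF this, of "1 + K x"] show ?thesis
      using K0[of x] x by (auto simp: Q_def add_nonneg_eq_0_iff)
  qed
  then obtain L where L: "\<And>x. x \<in> Q \<Longrightarrow> (\<lambda>n. f (r n) x) \<longlonglongrightarrow> L x"
    by metis
  have Lmono: "L x \<le> L y" if "x \<in> Q" "y \<in> Q" "x \<le> y" for x y
    using LIMSEQ_le[OF L[OF that(1)] L[OF that(2)]] mono that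
    by (auto simp: Q_def mono_on_def)
  have near: "\<exists>q\<in>Q. x - d < q \<and> q < x" "\<exists>q\<in>Q. x < q \<and> q < x + d"
    if x: "x \<in> S" and d: "0 < d" for x d :: real
  proof -
    obtain e where e: "0 < e" "ball x e \<subseteq> S"
      using S x open_contains_ball by blast
    obtain q where "q \<in> \<rat>" "x - min d e < q" "q < x"
      using Rats_dense_in_real[of "x - min d e" x] d e by auto
    with e show "\<exists>q\<in>Q. x - d < q \<and> q < x"
      by (intro bexI[of _ q]) (auto simp: Q_def dist_real_def subset_iff)
    obtain q where "q \<in> \<rat>" "x < q" "q < x + min d e"
      using Rats_dense_in_real[of x "x + min d e"] d e by auto
    with e show "\<exists>q\<in>Q. x < q \<and> q < x + d"
      by (intro bexI[of _ q]) (auto simp: Q_def dist_real_def subset_iff)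
  qed
  \<comment> \<open>Extension of \<open>L\<close> from the left. Openness of \<open>S\<close>
    provides points of \<open>Q\<close> on both sides of each \<open>x\<close> in \<open>S\<close>:
    those on the left make the supremum nonempty, one on the right bounds it.\<close>
  define F where "F x = (SUP q\<in>{q\<in>Q. q \<le> x}. L q)" for x
  have ne: "{q\<in>Q. q \<le> x} \<noteq> {}" if "x \<in> S" for x
    using near(1)[OF that, of 1] by force
  have bdd: "bdd_above (L ` {q\<in>Q. q \<le> x})" if x: "x \<in> S" for x
  proof -
    obtain q' where "q' \<in> Q" "x < q'"
      using near(2)[OF x, of 1] by auto
    then show ?thesis
      by (intro bdd_aboveI[of _ "L q'"]) (auto intro!: Lmono)
  qed
  have FQ: "F q = L q" if "q \<in> Q" for q
  proof (rule antisym)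
    show "F q \<le> L q"
      unfolding F_def using that by (intro cSUP_least ne) (auto simp: Q_def intro!: Lmono)
    show "L q \<le> F q"
      unfolding F_def using that by (intro cSUP_upper bdd) (auto simp: Q_def)
  qed
  show thesis
  proof (rule that[OF r, of F])
    show "mono_on S F"
      unfolding F_def by (intro mono_onI cSUP_subset_mono ne bdd) auto
  next
    fix x assume x: "x \<in> S" and cont: "isCont F x"
    have tend: "(F \<longlongrightarrow> F x) (at x)"
      using cont by (simp add: isCont_def)
    show "(\<lambda>n. f (r n) x) \<longlonglongrightarrow> F x"
    proof (rule order_tendstoI)
      fix a assume "a < F x"
      then obtain d where d: "0 < d" "\<And>y. y \<noteq> x \<Longrightarrow> dist y x < d \<Longrightarrow> a < F y"
        using order_tendstoD(1)[OF tend] unfolding eventually_at by blast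
      obtain q where q: "q \<in> Q" "x - d < q" "q < x"
        using near(1)[OF x d(1)] by blast
      have "a < L q"
        using d(2)[of q] q FQ by (auto simp: dist_real_def)
      then have "\<forall>\<^sub>F n in sequentially. a < f (r n) q"
        using order_tendstoD(1)[OF L[OF q(1)]] by blast
      then show "\<forall>\<^sub>F n in sequentially. a < f (r n) x"
      proof eventually_elim
        case (elim n)
        then show ?case
          using mono_onD[OF mono[of "r n"], of q x] q x by (auto simp: Q_def)
      qed
    next
      fix a assume "F x < a"
      then obtain d where d: "0 < d" "\<And>y. y \<noteq> x \<Longrightarrow> dist y x < d \<Longrightarrow> F y < a"
        using order_tendstoD(2)[OF tend] unfolding eventually_at by blast
      obtain q where q: "q \<in> Q" "x < q" "q < x + d"
        using near(2)[OF x d(1)] by blast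
      have "L q < a"
        using d(2)[of q] q FQ by (auto simp: dist_real_def)
      then have "\<forall>\<^sub>F n in sequentially. f (r n) q < a"
        using order_tendstoD(2)[OF L[OF q(1)]] by blast
      then show "\<forall>\<^sub>F n in sequentially. f (r n) x < a"
      proof eventually_elim
        case (elim n)
        then show ?case
          using mono_onD[OF mono[of "r n"], of x q] q x by (auto simp: Q_def)
      qed
    qed
  qed
qed

section \<open>Measurability of superlevel sets and hollows\<close>

lemma superlevel_in_sets:
  assumes "f \<in> borel_measurable (lebesgue_on {0..})"
  shows "superlevel f \<kappa> \<in> sets lebesgue"
proof -
  have "{x \<in> space (lebesgue_on {0..}). \<kappa> \<le> f x} \<in> sets (lebesgue_on {0..})"
    using assms by measurable
  moreover have "{x \<in> space (lebesgue_on {0..}). \<kappa> \<le> f x} = superlevel f \<kappa>"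
    by (auto simp: superlevel_def)
  ultimately show ?thesis
    by (simp add: sets_restrict_space_iff)
qed

lemma superlevel_antimono: "\<kappa> \<le> \<kappa>' \<Longrightarrow> superlevel f \<kappa>' \<subseteq> superlevel f \<kappa>"
  by (auto simp: superlevel_def)

text \<open>If \<open>B\<close> is a competitor for \<open>A'\<close>, then
  \<open>A \<inter> B\<close> is one for \<open>A\<close>, because \<open>A - B\<close> lies in
  \<open>A' - B\<close>; its hull lies in that of \<open>B\<close>.\<close>

lemma conv_ess_mono:
  assumes "A \<subseteq> A'" "A \<in> sets lebesgue" "A' \<in> sets lebesgue"
  shows "conv_ess A \<subseteq> conv_ess A'"
  unfolding conv_ess_def
proof (rule Inter_greatest)
  fix C
  assume "C \<in> {convex hull B |B. B \<subseteq> {0..} \<and> B \<in> sets lebesgue \<and>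
                emeasure lebesgue (sym_diff A' B) = 0}"
  then obtain B where B: "C = convex hull B" "B \<subseteq> {0..}" "B \<in> sets lebesgue"
    "emeasure lebesgue (sym_diff A' B) = 0"
    by blast
  have "emeasure lebesgue (sym_diff A (A \<inter> B)) \<le> emeasure lebesgue (sym_diff A' B)"
    using assms B by (intro emeasure_mono) auto
  then have "\<Inter> {convex hull B |B. B \<subseteq> {0..} \<and> B \<in> sets lebesgue \<and>
               emeasure lebesgue (sym_diff A B) = 0} \<subseteq> convex hull (A \<inter> B)"
    using assms B by (intro Inter_lower CollectI exI[of _ "A \<inter> B"]) auto
  also have "\<dots> \<subseteq> C"
    unfolding B(1) by (intro hull_mono) auto
  finally show "\<Inter> {convex hull B |B. B \<subseteq> {0..} \<and> B \<in> sets lebesgue \<and>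
                  emeasure lebesgue (sym_diff A B) = 0} \<subseteq> C" .
qed

lemma conv_ess_in_sets: "conv_ess A \<in> sets lebesgue"
proof -
  have "convex (conv_ess A)"
    unfolding conv_ess_def by (intro convex_Inter) (auto simp: convex_convex_hull)
  then have "conv_ess A \<in> sets borel"
    by (intro real_interval_borel_measurable) (simp add: is_interval_convex_1)
  then show ?thesis
    by simp
qed

text \<open>The union over all finite levels reduces to a countable one. A point \<open>x\<close> in
  the hollows at level \<open>\<kappa>\<close> has \<open>f x < \<kappa>\<close>, and it stays in
  the hollows at any rational level in between, since lowering the level enlarges the essential
  hull.\<close>

lemma hollows_below_infinity_in_sets:
  assumes f: "f \<in> borel_measurable (lebesgue_on {0..})"
  shows "hollows_below \<infinity> f \<in> sets lebesgue"
proof -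
  have "hollows_below \<infinity> f =
      (\<Union>q::rat. hollows (superlevel f (ennreal (real_of_rat q))))"
  proof (intro subset_antisym subsetI)
    fix x assume "x \<in> hollows_below \<infinity> f"
    then obtain \<kappa> where \<kappa>: "\<kappa> < \<infinity>" "x \<in> conv_ess (superlevel f \<kappa>)" "x \<notin> superlevel f \<kappa>"
      by (auto simp: hollows_below_def hollows_def)
    have conv: "x \<in> conv_ess (superlevel f \<kappa>')" if "\<kappa>' \<le> \<kappa>" for \<kappa>'
      using \<kappa>(2) conv_ess_mono[OF superlevel_antimono[OF that, of f]] superlevel_in_sets[OF f]
      by blast
    show "x \<in> (\<Union>q::rat. hollows (superlevel f (ennreal (real_of_rat q))))"
    proof (cases "0 \<le> x")
      case True
      then have "f x < \<kappa>"
        using \<kappa>(3) by (auto simp: superlevel_def)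
      then obtain q :: rat where q: "f x < ennreal (real_of_rat q)" "ennreal (real_of_rat q) < \<kappa>"
        using ennreal_rat_dense by blast
      then have "x \<in> hollows (superlevel f (ennreal (real_of_rat q)))"
        using conv[of "ennreal (real_of_rat q)"] by (auto simp: hollows_def superlevel_def)
      then show ?thesis by blast
    next
      \<comment> \<open>A negative point lies in no superlevel set, so the lowest level 0
        serves.\<close>
      case False
      then have "x \<in> hollows (superlevel f (ennreal (real_of_rat 0)))"
        using conv[of 0] by (auto simp: hollows_def superlevel_def)
      then show ?thesis by blast
    qed
  qed (auto simp: hollows_below_def)
  also have "\<dots> \<in> sets lebesgue"
    unfolding hollows_def
    by (intro sets.countable_UN sets.Diff conv_ess_in_sets superlevel_in_sets[OF f] image_subsetI)
  finally show ?thesis .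
qed

section \<open>Essential infimum and essential convex hull\<close>

text \<open>Each rational below the essential infimum is exceeded by some \<open>a\<close> for which
  \<open>A \<inter> {0..a}\<close> is null. Countably many such null pieces cover the part of
  \<open>A\<close> in question.\<close>

lemma null_sets_Int_less_inf_ess:
  assumes A: "A \<in> sets lebesgue"
  shows "A \<inter> {x. 0 \<le> x \<and> ennreal x < inf_ess A} \<in> null_sets lebesgue"
proof (rule null_sets_subset)
  define Q where "Q = {q :: rat. 0 \<le> real_of_rat q \<and> ennreal (real_of_rat q) < inf_ess A}"
  show "(\<Union>q\<in>Q. A \<inter> {0..real_of_rat q}) \<in> null_sets lebesgue"
  proof (intro null_sets_UN')
    fix q assume "q \<in> Q"
    then obtain a where a: "0 \<le> a" "emeasure lebesgue (A \<inter> {0..a}) = 0" "real_of_rat q < a"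
      by (auto simp: Q_def inf_ess_def less_SUP_iff ennreal_less_iff)
    have "A \<inter> {0..a} \<in> null_sets lebesgue"
      using A a by (auto simp: null_sets_def)
    then show "A \<inter> {0..real_of_rat q} \<in> null_sets lebesgue"
      by (rule null_sets_subset) (use A a in auto)
  qed auto
  show "A \<inter> {x. 0 \<le> x \<and> ennreal x < inf_ess A} \<in> sets lebesgue"
  proof -
    have "{x. 0 \<le> x \<and> ennreal x < inf_ess A} \<in> sets borel"
      by measurable
    with A show ?thesis by auto
  qed
  show "A \<inter> {x. 0 \<le> x \<and> ennreal x < inf_ess A} \<subseteq> (\<Union>q\<in>Q. A \<inter> {0..real_of_rat q})"
  proof
    fix x assume x: "x \<in> A \<inter> {x. 0 \<le> x \<and> ennreal x < inf_ess A}"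
    then obtain q :: rat where q: "ennreal x < ennreal (real_of_rat q)" "ennreal (real_of_rat q) < inf_ess A"
      using ennreal_rat_dense by blast
    then have xq: "x < real_of_rat q"
      using x by (auto simp: ennreal_less_iff)
    have "0 \<le> real_of_rat q"
      by (rule order_trans[OF _ less_imp_le[OF xq]]) (use x in auto)
    with xq q x have "q \<in> Q" "x \<in> A \<inter> {0..real_of_rat q}"
      by (simp_all add: Q_def)
    then show "x \<in> (\<Union>q\<in>Q. A \<inter> {0..real_of_rat q})"
      by blast
  qed
qed

text \<open>An infinite essential infimum would leave all of \<open>A\<close> below it, hence
  null.\<close>

lemma inf_ess_less_top:
  assumes A: "A \<in> sets lebesgue" "A \<subseteq> {0..}" "emeasure lebesgue A \<noteq> 0"
  shows "inf_ess A < \<infinity>"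
proof (rule ccontr)
  assume "\<not> inf_ess A < \<infinity>"
  then have "A \<inter> {x. 0 \<le> x \<and> ennreal x < inf_ess A} = A"
    using A(2) by (auto simp: less_top[symmetric])
  then show False
    using null_sets_Int_less_inf_ess[OF A(1)] A(3) by auto
qed

text \<open>For a null set every \<open>a\<close> is admissible in the supremum, which is then
  infinite. This is how a finite \<open>x_level\<close> at one level yields a superlevel set of
  positive measure.\<close>

lemma emeasure_nonzero_of_inf_ess_less_top:
  assumes "A \<in> sets lebesgue" "inf_ess A < \<infinity>"
  shows "emeasure lebesgue A \<noteq> 0"
proof
  assume "emeasure lebesgue A = 0"
  then have A: "A \<in> null_sets lebesgue"
    using assms by auto
  have "emeasure lebesgue (A \<inter> {0..a}) = 0" for a
    using null_set_Int2[OF A, of "{0..a}"] by (auto simp: Int_commute)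
  then have *: "ennreal a \<le> inf_ess A" if "0 \<le> a" for a
    unfolding inf_ess_def using that by (intro SUP_upper) auto
  obtain b where "inf_ess A = ennreal b" "0 \<le> b"
    using assms by (cases "inf_ess A") auto
  then show False
    using *[of "b + 1"] by (simp add: ennreal_le_iff)
qed

lemma inf_ess_antimono:
  assumes "A \<subseteq> A'" "A \<in> sets lebesgue" "A' \<in> sets lebesgue"
  shows "inf_ess A' \<le> inf_ess A"
  unfolding inf_ess_def
proof (rule SUP_subset_mono)
  show "{a. 0 \<le> a \<and> emeasure lebesgue (A' \<inter> {0..a}) = 0}
      \<subseteq> {a. 0 \<le> a \<and> emeasure lebesgue (A \<inter> {0..a}) = 0}"
  proof safe
    fix a :: real assume "emeasure lebesgue (A' \<inter> {0..a}) = 0"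
    moreover have "emeasure lebesgue (A \<inter> {0..a}) \<le> emeasure lebesgue (A' \<inter> {0..a})"
      using assms by (intro emeasure_mono) auto
    ultimately show "emeasure lebesgue (A \<inter> {0..a}) = 0" by simp
  qed
qed simp

text \<open>\<open>A\<close> has mass on both \<open>{0..t}\<close> and \<open>{t..}\<close>, so
  every \<open>B\<close> that agrees with \<open>A\<close> up to a null set has points on both sides
  of \<open>t\<close>.\<close>

lemma mem_conv_ess:
  assumes A: "A \<in> sets lebesgue"
    and t: "inf_ess A < ennreal t" "emeasure lebesgue (A \<inter> {t..}) \<noteq> 0"
  shows "t \<in> conv_ess A"
  unfolding conv_ess_def
proof safe
  fix B assume B: "B \<in> sets lebesgue" "emeasure lebesgue (sym_diff A B) = 0"
  have t0: "0 < t"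
    using t(1) by (metis ennreal_neg linorder_not_less not_less_zero)
  have meets: "\<exists>b\<in>B. b \<in> I" if I: "I \<in> sets lebesgue" "emeasure lebesgue (A \<inter> I) \<noteq> 0" for I
  proof (rule ccontr)
    assume "\<not> ?thesis"
    then have "A \<inter> I \<subseteq> sym_diff A B" by auto
    then have "emeasure lebesgue (A \<inter> I) \<le> emeasure lebesgue (sym_diff A B)"
      using A B by (intro emeasure_mono) auto
    with B I show False by simp
  qed
  have "emeasure lebesgue (A \<inter> {0..t}) \<noteq> 0"
  proof
    assume "emeasure lebesgue (A \<inter> {0..t}) = 0"
    then have "ennreal t \<le> inf_ess A"
      unfolding inf_ess_def using t0 by (intro SUP_upper) auto
    with t(1) show False by simp
  qed
  then obtain b c where b: "b \<in> B" "b \<le> t" and c: "c \<in> B" "t \<le> c"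
    using meets[of "{0..t}"] meets[of "{t..}"] t(2) by auto
  have "t \<in> closed_segment b c"
    using b c by (simp add: closed_segment_eq_real_ivl)
  also have "\<dots> \<subseteq> convex hull B"
    using b c by (simp add: convex_contains_segment[THEN iffD1, OF convex_convex_hull] hull_inc)
  finally show "t \<in> convex hull B" .
qed

section \<open>Nestedness of the tamped intervals\<close>

text \<open>The hollows occupy a subset of \<open>{0..X}\<close> of finite measure, so the truncated
  subtraction is the measure of a difference. In this form \<open>y_level\<close> is visibly
  monotone in \<open>X\<close>.\<close>

lemma y_level_eq:
  assumes f: "f \<in> borel_measurable (lebesgue_on {0..})" and X: "x_level \<nu> f = ennreal X" "0 \<le> X"
  shows "y_level \<nu> f = emeasure lebesgue ({0..X} - hollows_below \<infinity> f)"
proof -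
  let ?H = "hollows_below \<infinity> f"
  note H = hollows_below_infinity_in_sets[OF f]
  have "{x. 0 \<le> x \<and> ennreal x \<le> x_level \<nu> f} = {0..X}"
    using X by (auto simp: ennreal_le_iff)
  then have "y_level \<nu> f = emeasure lebesgue {0..X} - emeasure lebesgue (?H \<inter> {0..X})"
    using X by (simp add: y_level_def)
  also have "\<dots> = emeasure lebesgue ({0..X} - ?H \<inter> {0..X})"
  proof (rule emeasure_Diff[symmetric])
    have "emeasure lebesgue (?H \<inter> {0..X}) \<le> emeasure lebesgue {0..X}"
      by (intro emeasure_mono) auto
    then show "emeasure lebesgue (?H \<inter> {0..X}) \<noteq> \<infinity>"
      using X by (auto simp: top_unique)
  qed (use H in auto)
  also have "{0..X} - ?H \<inter> {0..X} = {0..X} - ?H"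
    by auto
  finally show ?thesis .
qed

text \<open>The left endpoint increases because the essential infimum does. Its gain from
  \<open>\<kappa>\<close> to \<open>\<nu>\<close> is at most the measure of the set \<open>D\<close>
  of points outside the hollows between the two essential infima. \<open>D\<close> is contained in
  the lower superlevel set and almost disjoint from the upper one, so the gain is paid for by the
  loss of measure.\<close>

lemma level_nested:
  assumes f: "f \<in> borel_measurable (lebesgue_on {0..})"
    and le: "\<kappa> \<le> \<nu>" "\<kappa> < \<infinity>"
    and pos: "emeasure lebesgue (superlevel f \<nu>) \<noteq> 0"
  shows y_level_mono: "y_level \<kappa> f \<le> y_level \<nu> f"
    and y_level_add_antimono: "y_level \<nu> f + emeasure lebesgue (superlevel f \<nu>)
          \<le> y_level \<kappa> f + emeasure lebesgue (superlevel f \<kappa>)"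
    and y_level_less_top: "y_level \<nu> f < \<infinity>"
proof -
  let ?H = "hollows_below \<infinity> f" and ?A = "superlevel f \<nu>" and ?B = "superlevel f \<kappa>"
  note H = hollows_below_infinity_in_sets[OF f]
  have A: "?A \<in> sets lebesgue" and B: "?B \<in> sets lebesgue"
    using superlevel_in_sets[OF f] by auto
  have AB: "?A \<subseteq> ?B"
    using superlevel_antimono[OF le(1)] .
  have "inf_ess ?A < \<infinity>"
    using A pos by (intro inf_ess_less_top) (auto simp: superlevel_def)
  then obtain X where X: "inf_ess ?A = ennreal X" "0 \<le> X"
    by (cases "inf_ess ?A") auto
  have "inf_ess ?B \<le> ennreal X"
    using inf_ess_antimono[OF AB A B] X by simp
  then obtain Y where Y: "inf_ess ?B = ennreal Y" "0 \<le> Y" "Y \<le> X"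
    using X by (cases "inf_ess ?B") (auto simp: ennreal_le_iff top_unique)
  have yA: "y_level \<nu> f = emeasure lebesgue ({0..X} - ?H)"
    using y_level_eq[OF f] X by (simp add: x_level_def)
  have yB: "y_level \<kappa> f = emeasure lebesgue ({0..Y} - ?H)"
    using y_level_eq[OF f] Y by (simp add: x_level_def)
  show "y_level \<kappa> f \<le> y_level \<nu> f"
    unfolding yA yB using Y H by (intro emeasure_mono) auto
  have "y_level \<nu> f \<le> emeasure lebesgue {0..X}"
    unfolding yA by (intro emeasure_mono) auto
  then show "y_level \<nu> f < \<infinity>"
    using X by (auto simp: less_top[symmetric] top_unique)
  define D where "D = {Y<..<X} - ?H"
  have D: "D \<in> sets lebesgue"
    using H by (auto simp: D_def)
  have null: "?A \<inter> {0..<X} \<in> null_sets lebesgue"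
  proof -
    have "{x. 0 \<le> x \<and> ennreal x < inf_ess ?A} = {0..<X}"
      using X by (auto simp: ennreal_less_iff)
    then show ?thesis
      using null_sets_Int_less_inf_ess[OF A] by simp
  qed
  \<comment> \<open>Between the two essential infima a point outside the hollows lies in the larger superlevel
    set, hence almost surely in the difference of the two superlevel sets.\<close>
  have DB: "D \<subseteq> ?B"
  proof
    fix t assume t: "t \<in> D"
    \<comment> \<open>Otherwise \<open>?A\<close> would be null: its part below \<open>X\<close> is
      null anyway, and the rest lies in \<open>?B \<inter> {t..}\<close> because
      \<open>t < X\<close>.\<close>
    have "emeasure lebesgue (?B \<inter> {t..}) \<noteq> 0"
    proof
      assume "emeasure lebesgue (?B \<inter> {t..}) = 0"
      then have "?B \<inter> {t..} \<in> null_sets lebesgue"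
        using B by (intro null_setsI) auto
      then have "?A \<inter> {0..<X} \<union> ?B \<inter> {t..} \<in> null_sets lebesgue"
        using null by blast
      moreover have "?A \<subseteq> ?A \<inter> {0..<X} \<union> ?B \<inter> {t..}"
      proof
        fix s assume s: "s \<in> ?A"
        then have "0 \<le> s" "s \<in> ?B"
          using AB by (auto simp: superlevel_def)
        with s t show "s \<in> ?A \<inter> {0..<X} \<union> ?B \<inter> {t..}"
          by (cases "s < X") (simp_all add: D_def)
      qed
      ultimately have "?A \<in> null_sets lebesgue"
        using A null_sets_subset by blast
      with pos show False by auto
    qed
    then have "t \<in> conv_ess ?B"
      using t Y B by (intro mem_conv_ess) (auto simp: D_def ennreal_less_iff)
    \<comment> \<open>As \<open>\<kappa>\<close> is finite, the hollows of \<open>?B\<close> are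
      among those that \<open>t\<close> avoids, so a point of the essential hull is in
      \<open>?B\<close> itself.\<close>
    with t le show "t \<in> ?B"
      by (auto simp: D_def hollows_below_def hollows_def)
  qed
  have nullD: "?A \<inter> D \<in> null_sets lebesgue"
  proof (rule null_sets_subset[OF null])
    show "?A \<inter> D \<in> sets lebesgue"
      using A D by (rule sets.Int)
    have "D \<subseteq> {0..<X}"
      using Y(2) by (auto simp: D_def)
    then show "?A \<inter> D \<subseteq> ?A \<inter> {0..<X}"
      by blast
  qed
  \<comment> \<open>\<open>D\<close> is built on an open interval, so the endpoint \<open>X\<close>
    is added separately; it has measure 0.\<close>
  have "y_level \<nu> f \<le> emeasure lebesgue (({0..Y} - ?H) \<union> (D \<union> {X}))"
    unfolding yA using H D by (intro emeasure_mono sets.Un) (auto simp: D_def)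
  also have "\<dots> \<le> y_level \<kappa> f + emeasure lebesgue (D \<union> {X})"
    unfolding yB using H D by (intro emeasure_subadditive sets.Un) auto
  also have "emeasure lebesgue (D \<union> {X}) = emeasure lebesgue D"
    using D by (intro emeasure_Un_null_set) (auto intro: null_sets_completionI)
  finally have "y_level \<nu> f + emeasure lebesgue ?A
      \<le> y_level \<kappa> f + (emeasure lebesgue D + emeasure lebesgue ?A)"
    by (simp add: add.assoc[symmetric] add_right_mono)
  \<comment> \<open>Discarding the null overlap makes the two pieces disjoint, so that their
    measures add up inside \<open>?B\<close>.\<close>
  also have "emeasure lebesgue ?A = emeasure lebesgue (?A - ?A \<inter> D)"
    using emeasure_Diff_null_set[OF nullD A] by simp
  also have "emeasure lebesgue D + emeasure lebesgue (?A - ?A \<inter> D) = emeasure lebesgue (D \<union> (?A - ?A \<inter> D))"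
    using A D by (intro plus_emeasure) auto
  also have "\<dots> \<le> emeasure lebesgue ?B"
    using AB DB B by (intro emeasure_mono) auto
  finally show "y_level \<nu> f + emeasure lebesgue ?A \<le> y_level \<kappa> f + emeasure lebesgue ?B"
    by (simp add: add_left_mono emeasure_Diff_null_set[OF nullD A])
qed

section \<open>Superlevel sets of the tamping as intervals\<close>

text \<open>The supremum defining the tamping need not be attained. Hence reaching
  \<open>\<nu>\<close> means that each \<open>\<kappa> < \<nu>\<close> is exceeded by some level
  whose tamped interval contains \<open>x\<close>.\<close>

lemma superlevel_tamping:
  assumes "0 < \<nu>"
  shows "superlevel (tamping f) (ennreal \<nu>) = {x. 0 \<le> x \<and>
    (\<forall>\<kappa>\<in>{0<..<\<nu>}. \<exists>\<kappa>'>\<kappa>. x \<in> tamped_level (ennreal \<kappa>') f)}"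
proof -
  have "ennreal \<nu> \<le> tamping f x \<longleftrightarrow> (\<forall>\<kappa>\<in>{0<..<\<nu>}. \<exists>\<kappa>'>\<kappa>. x \<in> tamped_level (ennreal \<kappa>') f)" for x
  proof
    assume L: "ennreal \<nu> \<le> tamping f x"
    show "\<forall>\<kappa>\<in>{0<..<\<nu>}. \<exists>\<kappa>'>\<kappa>. x \<in> tamped_level (ennreal \<kappa>') f"
    proof
      fix \<kappa> assume \<kappa>: "\<kappa> \<in> {0<..<\<nu>}"
      then have "ennreal \<kappa> < tamping f x"
        using L by (auto intro!: less_le_trans[OF _ L] simp: ennreal_less_iff)
      then obtain z where z: "ennreal \<kappa> < z" "z < \<infinity>" "x \<in> tamped_level z f"
        unfolding tamping_def less_Sup_iff by auto
      then obtain \<kappa>' where "z = ennreal \<kappa>'" "0 \<le> \<kappa>'"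
        by (cases z) auto
      with z \<kappa> show "\<exists>\<kappa>'>\<kappa>. x \<in> tamped_level (ennreal \<kappa>') f"
        by (auto simp: ennreal_less_iff)
    qed
  next
    assume R: "\<forall>\<kappa>\<in>{0<..<\<nu>}. \<exists>\<kappa>'>\<kappa>. x \<in> tamped_level (ennreal \<kappa>') f"
    have le: "ennreal \<kappa> \<le> tamping f x" if \<kappa>: "\<kappa> \<in> {0<..<\<nu>}" for \<kappa>
    proof -
      obtain \<kappa>' where \<kappa>': "\<kappa>' > \<kappa>" "x \<in> tamped_level (ennreal \<kappa>') f"
        using bspec[OF R \<kappa>] by (elim exE conjE)
      then have "ennreal \<kappa> \<le> ennreal \<kappa>'"
        by (simp add: ennreal_leI)
      also have "\<dots> \<le> tamping f x"
        unfolding tamping_def using \<kappa>' that by (intro Sup_upper) auto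
      finally show ?thesis .
    qed
    show "ennreal \<nu> \<le> tamping f x"
    proof (rule dense_le)
      fix z assume z: "z < ennreal \<nu>"
      \<comment> \<open>The bound \<open>z\<close> may be 0; a value strictly above it corresponds
        to a positive level.\<close>
      then obtain w where w: "z < w" "w < ennreal \<nu>"
        using dense by blast
      then obtain \<kappa> where "w = ennreal \<kappa>" "0 \<le> \<kappa>"
        by (cases w) auto
      with w have "\<kappa> \<in> {0<..<\<nu>}"
        by (cases "\<kappa> = 0") (auto simp: ennreal_less_iff)
      from le[OF this] show "z \<le> tamping f x"
        using w \<open>w = ennreal \<kappa>\<close> by auto
    qed
  qed
  then show ?thesis
    by (auto simp: superlevel_def)
qed

text \<open>By nestedness the superlevel set at \<open>\<nu>\<close> is the intersection of the
  tamped intervals at the levels below \<open>\<nu>\<close>, so its endpoints are a supremum of left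
  and an infimum of right endpoints. Comparison with the level \<open>\<nu> / 2\<close> bounds its
  length, whence \<open>m (\<nu> / 2)\<close>.\<close>

lemma tamping_levels_are_intervals:
  assumes f: "f \<in> borel_measurable (lebesgue_on {0..})"
    and m: "\<And>\<nu>. 0 < \<nu> \<Longrightarrow> emeasure lebesgue (superlevel f (ennreal \<nu>)) \<le> ennreal (m \<nu>)"
    and m0: "\<And>\<nu>. 0 < \<nu> \<Longrightarrow> 0 \<le> m \<nu>"
    and \<mu>: "0 < \<mu>" "x_level (ennreal \<mu>) f \<le> ennreal R" "0 \<le> R"
  obtains \<alpha> \<beta> :: "real \<Rightarrow> real"
  where "mono_on {0<..} \<alpha>" "antimono_on {0<..} \<beta>"
    "\<And>\<nu>. 0 < \<nu> \<Longrightarrow> superlevel (tamping f) (ennreal \<nu>) = {\<alpha> \<nu>..\<beta> \<nu>}"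
    "\<And>\<nu>. 0 < \<nu> \<Longrightarrow> 0 \<le> \<alpha> \<nu>" "\<And>\<nu>. 0 < \<nu> \<Longrightarrow> \<alpha> \<nu> \<le> R + m \<mu> + 1" "\<And>\<nu>. 0 < \<nu> \<Longrightarrow> 0 \<le> \<beta> \<nu>"
    "\<And>\<nu>. 0 < \<nu> \<Longrightarrow> \<beta> \<nu> \<le> \<alpha> \<nu> + m (\<nu> / 2)"
proof -
  define M where "M \<nu> = emeasure lebesgue (superlevel f (ennreal \<nu>))" for \<nu>
  define y where "y \<nu> = y_level (ennreal \<nu>) f" for \<nu>
  \<comment> \<open>\<open>R + m \<mu>\<close> bounds the right endpoint at level
    \<open>\<mu>\<close>; the extra 1 ensures \<open>K > 0\<close>. At null levels the endpoints are
    set to \<open>K\<close> and 0. This encodes the empty interval and keeps \<open>a\<close>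
    increasing and \<open>b\<close> decreasing.\<close>
  define K where "K = R + m \<mu> + 1"
  have K: "0 < K"
    using m0[OF \<mu>(1)] \<mu>(3) by (simp add: K_def)
  define a where "a \<nu> = (if M \<nu> = 0 then K else enn2real (y \<nu>))" for \<nu>
  define b where "b \<nu> = (if M \<nu> = 0 then 0 else enn2real (y \<nu> + M \<nu>))" for \<nu>
  note sets = superlevel_in_sets[OF f]
  have Mfin: "M \<nu> < \<infinity>" if "0 < \<nu>" for \<nu>
    using m[OF that] by (auto simp: M_def less_top[symmetric] top_unique)
  have Mmono: "M \<nu> \<le> M \<kappa>" if "\<kappa> \<le> \<nu>" for \<kappa> \<nu>
    unfolding M_def using superlevel_antimono[of "ennreal \<kappa>" "ennreal \<nu>" f] that sets
    by (intro emeasure_mono) (auto simp: ennreal_leI)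
  have Mpos: "M \<kappa> \<noteq> 0" if "\<kappa> \<le> \<nu>" "M \<nu> \<noteq> 0" for \<kappa> \<nu>
    using Mmono[OF that(1)] that(2) by auto
  have yfin: "y \<nu> < \<infinity>" if "M \<nu> \<noteq> 0" for \<nu>
    using y_level_less_top[OF f, of "ennreal \<nu>" "ennreal \<nu>"] that by (simp add: M_def y_def)
  have ymono: "y \<kappa> \<le> y \<nu>" if "\<kappa> \<le> \<nu>" "M \<nu> \<noteq> 0" for \<kappa> \<nu>
    using y_level_mono[OF f, of "ennreal \<kappa>" "ennreal \<nu>"] that by (simp add: M_def y_def ennreal_leI)
  have zmono: "y \<nu> + M \<nu> \<le> y \<kappa> + M \<kappa>" if "\<kappa> \<le> \<nu>" "M \<nu> \<noteq> 0" for \<kappa> \<nu>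
    using y_level_add_antimono[OF f, of "ennreal \<kappa>" "ennreal \<nu>"] that
    by (simp add: M_def y_def ennreal_leI)
  have M\<mu>: "M \<mu> \<noteq> 0"
    unfolding M_def
    by (rule emeasure_nonzero_of_inf_ess_less_top)
      (use sets \<mu> in \<open>auto simp: x_level_def le_less_trans[OF \<mu>(2)[unfolded x_level_def]]\<close>)
  have z\<mu>: "y \<mu> + M \<mu> \<le> ennreal K"
  proof -
    have "y \<mu> \<le> ennreal R"
      unfolding y_def y_level_def using \<mu>(2) diff_le_self_ennreal order_trans by blast
    then have "y \<mu> + M \<mu> \<le> ennreal R + ennreal (m \<mu>)"
      using m[OF \<mu>(1)] by (intro add_mono) (auto simp: M_def)
    also have "\<dots> \<le> ennreal K"
      using \<mu> m0[OF \<mu>(1)] by (simp add: K_def ennreal_leI flip: ennreal_plus)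
    finally show ?thesis .
  qed
  \<comment> \<open>Below \<open>\<mu>\<close> the left endpoint is at most the one at
    \<open>\<mu>\<close>; above \<open>\<mu>\<close> the whole interval lies inside the one at
    \<open>\<mu>\<close>.\<close>
  have yK: "y \<nu> \<le> ennreal K" if "M \<nu> \<noteq> 0" for \<nu>
  proof (cases "\<nu> \<le> \<mu>")
    case True
    have "y \<nu> \<le> y \<mu>" using ymono[OF True M\<mu>] .
    also have "\<dots> \<le> y \<mu> + M \<mu>" by simp
    finally show ?thesis using z\<mu> by simp
  next
    case False
    have "y \<nu> \<le> y \<nu> + M \<nu>" by simp
    also have "\<dots> \<le> y \<mu> + M \<mu>" using zmono[of \<mu> \<nu>] False that by simp
    finally show ?thesis using z\<mu> by simp
  qed
  have a0: "0 \<le> a \<nu>" and b0: "0 \<le> b \<nu>" for \<nu>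
    using K by (auto simp: a_def b_def)
  have aK: "a \<nu> \<le> K" for \<nu>
    using enn2real_mono[OF yK, of \<nu>] K by (auto simp: a_def)
  have amono: "a \<kappa> \<le> a \<nu>" if "0 < \<kappa>" "\<kappa> \<le> \<nu>" for \<kappa> \<nu>
  proof (cases "M \<nu> = 0")
    case True
    then show ?thesis using aK by (simp add: a_def[of \<nu>])
  next
    case False
    then show ?thesis
      using Mpos[OF that(2)] yfin ymono[OF that(2)] by (auto simp: a_def intro!: enn2real_mono)
  qed
  have bmono: "b \<nu> \<le> b \<kappa>" if "0 < \<kappa>" "\<kappa> \<le> \<nu>" for \<kappa> \<nu>
  proof (cases "M \<nu> = 0")
    case True
    then show ?thesis using b0 by (simp add: b_def[of \<nu>])
  next
    case False
    then have "y \<kappa> + M \<kappa> < \<infinity>"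
      using Mpos[OF that(2)] yfin[of \<kappa>] Mfin[of \<kappa>] that by (auto simp: less_top[symmetric])
    then show ?thesis
      using False Mpos[OF that(2)] zmono[OF that(2)] by (auto simp: b_def intro!: enn2real_mono)
  qed
  have bm: "b \<nu> \<le> a \<nu> + m \<nu>" if "0 < \<nu>" for \<nu>
  proof (cases "M \<nu> = 0")
    case True
    then show ?thesis using K m0[OF that] by (simp add: a_def b_def)
  next
    case False
    have "enn2real (M \<nu>) \<le> m \<nu>"
      using m[OF that] m0[OF that] by (intro enn2real_leI) (auto simp: M_def)
    then show ?thesis
      using False yfin[OF False] Mfin[OF that]
      by (simp add: a_def b_def enn2real_plus)
  qed
  have tamped: "tamped_level (ennreal \<nu>) f = {a \<nu>..b \<nu>}" if \<nu>: "0 < \<nu>" for \<nu>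
  proof (cases "M \<nu> = 0")
    case True
    then show ?thesis
      using K by (simp add: tamped_level_def M_def[symmetric] a_def b_def)
  next
    case False
    obtain u where u: "y \<nu> = ennreal u" "0 \<le> u"
      using yfin[OF False] by (cases "y \<nu>") auto
    obtain v where v: "M \<nu> = ennreal v" "0 \<le> v"
      using Mfin[OF \<nu>] by (cases "M \<nu>") auto
    have "tamped_level (ennreal \<nu>) f = {x. 0 \<le> x \<and> y \<nu> \<le> ennreal x \<and> ennreal x \<le> y \<nu> + M \<nu>}"
      using False by (simp add: tamped_level_def M_def[symmetric] y_def[symmetric])
    also have "\<dots> = {u..u + v}"
      using u v by (auto simp: ennreal_le_iff simp flip: ennreal_plus)
    also have "\<dots> = {a \<nu>..b \<nu>}"
      using False u v by (simp add: a_def b_def flip: ennreal_plus)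
    finally show ?thesis .
  qed
  define \<alpha> where "\<alpha> \<nu> = (SUP \<kappa>\<in>{0<..<\<nu>}. a \<kappa>)" for \<nu>
  define \<beta> where "\<beta> \<nu> = (INF \<kappa>\<in>{0<..<\<nu>}. b \<kappa>)" for \<nu>
  have bdd: "bdd_above (a ` {0<..<\<nu>})" "bdd_below (b ` {0<..<\<nu>})" for \<nu>
    using aK b0 by (auto intro!: bdd_aboveI[of _ K] bdd_belowI[of _ 0])
  have ne: "{0<..<\<nu>} \<noteq> {}" if "0 < \<nu>" for \<nu> :: real
    using that by simp
  show thesis
  proof (rule that[of \<alpha> \<beta>])
    show "mono_on {0<..} \<alpha>"
      unfolding \<alpha>_def by (intro mono_onI cSUP_subset_mono ne bdd) auto
    show "antimono_on {0<..} \<beta>"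
      unfolding \<beta>_def by (intro monotone_onI cINF_superset_mono ne bdd) auto
  next
    fix \<nu> :: real assume \<nu>: "0 < \<nu>"
    have "(\<exists>\<kappa>'>\<kappa>. x \<in> tamped_level (ennreal \<kappa>') f) \<longleftrightarrow> (\<exists>\<kappa>'>\<kappa>. x \<in> {a \<kappa>'..b \<kappa>'})"
      if "\<kappa> \<in> {0<..<\<nu>}" for x \<kappa>
      using that by (intro ex_cong1 conj_cong refl) (simp add: tamped)
    then have "superlevel (tamping f) (ennreal \<nu>) =
        {x. 0 \<le> x \<and> (\<forall>\<kappa>\<in>{0<..<\<nu>}. \<exists>\<kappa>'>\<kappa>. x \<in> {a \<kappa>'..b \<kappa>'})}"
      unfolding superlevel_tamping[OF \<nu>] by simp
    \<comment> \<open>Membership at a higher level implies membership at \<open>\<kappa>\<close>.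
      Conversely, a level strictly between \<open>\<kappa>\<close> and \<open>\<nu>\<close> is a
      witness.\<close>
    also have "\<dots> = {x. \<forall>\<kappa>\<in>{0<..<\<nu>}. x \<in> {a \<kappa>..b \<kappa>}}"
    proof (intro subset_antisym subsetI)
      fix x assume x: "x \<in> {x. 0 \<le> x \<and> (\<forall>\<kappa>\<in>{0<..<\<nu>}. \<exists>\<kappa>'>\<kappa>. x \<in> {a \<kappa>'..b \<kappa>'})}"
      show "x \<in> {x. \<forall>\<kappa>\<in>{0<..<\<nu>}. x \<in> {a \<kappa>..b \<kappa>}}"
      proof (intro CollectI ballI)
        fix \<kappa> assume \<kappa>: "\<kappa> \<in> {0<..<\<nu>}"
        then obtain \<kappa>' where "\<kappa> < \<kappa>'" "x \<in> {a \<kappa>'..b \<kappa>'}"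
          using x by blast
        then show "x \<in> {a \<kappa>..b \<kappa>}"
          using amono[of \<kappa> \<kappa>'] bmono[of \<kappa> \<kappa>'] \<kappa> by auto
      qed
    next
      fix x assume x: "x \<in> {x. \<forall>\<kappa>\<in>{0<..<\<nu>}. x \<in> {a \<kappa>..b \<kappa>}}"
      have "\<exists>\<kappa>'>\<kappa>. x \<in> {a \<kappa>'..b \<kappa>'}" if "\<kappa> \<in> {0<..<\<nu>}" for \<kappa>
      proof -
        obtain \<kappa>' where "\<kappa> < \<kappa>'" "\<kappa>' < \<nu>"
          using dense \<open>\<kappa> \<in> {0<..<\<nu>}\<close> by auto
        then show ?thesis using x that by auto
      qed
      moreover have "0 \<le> x"
      proof -
        have "a (\<nu> / 2) \<le> x" using x \<nu> by auto
        with a0[of "\<nu> / 2"] show ?thesis by linarith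
      qed
      ultimately show "x \<in> {x. 0 \<le> x \<and> (\<forall>\<kappa>\<in>{0<..<\<nu>}. \<exists>\<kappa>'>\<kappa>. x \<in> {a \<kappa>'..b \<kappa>'})}"
        by blast
    qed
    also have "\<dots> = {\<alpha> \<nu>..\<beta> \<nu>}"
      unfolding \<alpha>_def \<beta>_def atLeastAtMost_def atLeast_def atMost_def
      using cSUP_le_iff[OF ne[OF \<nu>] bdd(1)] le_cINF_iff[OF ne[OF \<nu>] bdd(2)] by auto
    finally show "superlevel (tamping f) (ennreal \<nu>) = {\<alpha> \<nu>..\<beta> \<nu>}" .
    have half: "\<nu> / 2 \<in> {0<..<\<nu>}"
      using \<nu> by simp
    have a\<alpha>: "a (\<nu> / 2) \<le> \<alpha> \<nu>"
      unfolding \<alpha>_def using half bdd by (intro cSUP_upper)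
    then show "0 \<le> \<alpha> \<nu>"
      using a0[of "\<nu> / 2"] by linarith
    have b\<beta>: "\<beta> \<nu> \<le> b (\<nu> / 2)"
      unfolding \<beta>_def using half bdd by (intro cINF_lower)
    show "\<alpha> \<nu> \<le> R + m \<mu> + 1"
      unfolding \<alpha>_def K_def[symmetric] using ne[OF \<nu>] aK by (intro cSUP_least)
    show "0 \<le> \<beta> \<nu>"
      unfolding \<beta>_def using ne[OF \<nu>] b0 by (intro cINF_greatest)
    show "\<beta> \<nu> \<le> \<alpha> \<nu> + m (\<nu> / 2)"
      using a\<alpha> b\<beta> bm[of "\<nu> / 2"] \<nu> by linarith
  qed
qed

section \<open>Compactness of families of nested intervals\<close>

text \<open>Helly's theorem is applied to the left endpoints and then to the negated right
  endpoints. The limit intervals are the superlevel sets of a function \<open>\<Phi>\<close> at all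
  but countably many levels. Since \<open>m\<close> tends to 0, \<open>\<Phi>\<close> is infinite
  only on a null set and can be replaced by a real function.\<close>

lemma interval_superlevels_subsequence:
  fixes T :: "nat \<Rightarrow> real \<Rightarrow> ennreal" and \<alpha> \<beta> :: "nat \<Rightarrow> real \<Rightarrow> real"
  assumes mono: "\<And>n. mono_on {0<..} (\<alpha> n)" "\<And>n. antimono_on {0<..} (\<beta> n)"
    and level: "\<And>n \<nu>. 0 < \<nu> \<Longrightarrow> superlevel (T n) (ennreal \<nu>) = {\<alpha> n \<nu>..\<beta> n \<nu>}"
    and \<alpha>: "\<And>n \<nu>. 0 < \<nu> \<Longrightarrow> 0 \<le> \<alpha> n \<nu>" "\<And>n \<nu>. 0 < \<nu> \<Longrightarrow> \<alpha> n \<nu> \<le> K"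
    and \<beta>: "\<And>n \<nu>. 0 < \<nu> \<Longrightarrow> 0 \<le> \<beta> n \<nu>" "\<And>n \<nu>. 0 < \<nu> \<Longrightarrow> \<beta> n \<nu> \<le> \<alpha> n \<nu> + m \<nu>"
    and m: "(m \<longlongrightarrow> 0) at_top"
  obtains \<psi> :: "real \<Rightarrow> real" and r :: "nat \<Rightarrow> nat"
  where "\<psi> \<in> borel_measurable borel" "\<And>x. 0 \<le> \<psi> x" "strict_mono r"
    "AE \<nu> in lebesgue_on {0<..}. (\<lambda>n. emeasure lebesgue
       (sym_diff (superlevel (T (r n)) (ennreal \<nu>)) (superlevel (\<lambda>x. ennreal (\<psi> x)) (ennreal \<nu>))))
       \<longlonglongrightarrow> 0"
proof -
  obtain r1 A where r1: "strict_mono (r1 :: nat \<Rightarrow> nat)" and A: "mono_on {0<..} A"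
    and limA: "\<And>\<nu>. \<nu> \<in> {0<..} \<Longrightarrow> isCont A \<nu> \<Longrightarrow> (\<lambda>n. \<alpha> (r1 n) \<nu>) \<longlonglongrightarrow> A \<nu>"
    by (rule helly_selection_mono_on[of "{0<..}" \<alpha> "\<lambda>_. K"]) (use mono(1) \<alpha> in auto)
  \<comment> \<open>The sign turns decreasing right endpoints into increasing functions; hence the
    limit right endpoint is \<open>- B\<close>.\<close>
  have mono': "mono_on {0<..} (\<lambda>\<nu>. - \<beta> (r1 n) \<nu>)" for n
    using mono(2)[of "r1 n"] by (auto simp: monotone_on_def)
  have bd': "\<bar>- \<beta> (r1 n) \<nu>\<bar> \<le> K + m \<nu>" if "\<nu> \<in> {0<..}" for n \<nu>
    using \<alpha>(2)[of \<nu> "r1 n"] \<beta>[of \<nu> "r1 n"] that by auto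
  obtain r2 B where r2: "strict_mono (r2 :: nat \<Rightarrow> nat)" and B: "mono_on {0<..} B"
    and limB: "\<And>\<nu>. \<nu> \<in> {0<..} \<Longrightarrow> isCont B \<nu> \<Longrightarrow> (\<lambda>n. - \<beta> (r1 (r2 n)) \<nu>) \<longlonglongrightarrow> B \<nu>"
    by (rule helly_selection_mono_on[of "{0<..}" "\<lambda>n \<nu>. - \<beta> (r1 n) \<nu>" "\<lambda>\<nu>. K + m \<nu>"])
      (use mono' bd' in auto)
  define r where "r = r1 \<circ> r2"
  have r: "strict_mono r"
    unfolding r_def using r1 r2 by (rule strict_mono_o)
  define D where "D = {\<nu>\<in>{0<..}. \<not> isCont A \<nu>} \<union> {\<nu>\<in>{0<..}. \<not> isCont B \<nu>}"
  have D: "countable D"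
    unfolding D_def using A B by (intro countable_Un mono_on_ctble_discont_open) auto
  have lim\<alpha>: "(\<lambda>n. \<alpha> (r n) \<nu>) \<longlonglongrightarrow> A \<nu>" if "0 < \<nu>" "\<nu> \<notin> D" for \<nu>
    using LIMSEQ_subseq_LIMSEQ[OF limA r2, of \<nu>] that by (auto simp: D_def r_def o_def)
  have lim\<beta>: "(\<lambda>n. \<beta> (r n) \<nu>) \<longlonglongrightarrow> - B \<nu>" if "0 < \<nu>" "\<nu> \<notin> D" for \<nu>
    using tendsto_minus[OF limB, of \<nu>] that by (auto simp: D_def r_def o_def)

  \<comment> \<open>The largest level whose limit interval contains \<open>x\<close>, taken over
    positive rational levels so that the supremum is countable and measurable.\<close>
  define \<Phi> where "\<Phi> x = (SUP q::rat. ennreal (real_of_rat q) *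
    indicator {x. 0 < q \<and> x \<in> {A (real_of_rat q)..- B (real_of_rat q)}} x)" for x
  define \<psi> where "\<psi> x = enn2real (\<Phi> x)" for x
  have \<Phi>: "\<Phi> \<in> borel_measurable borel"
    unfolding \<Phi>_def by measurable
  define N where "N = {x. \<Phi> x = \<infinity>}"
  \<comment> \<open>Nestedness carries membership from rational levels to all real ones. The two
    implications differ only by strictness, which continuity of \<open>A\<close> and
    \<open>B\<close> removes at levels outside \<open>D\<close>.\<close>
  have \<Phi>_less: "ennreal \<kappa> < \<Phi> x \<Longrightarrow> x \<in> {A \<kappa>..- B \<kappa>}" if "0 < \<kappa>" for \<kappa> x
  proof -
    assume "ennreal \<kappa> < \<Phi> x"
    then obtain q :: rat where q: "ennreal \<kappa> < ennreal (real_of_rat q) *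
        indicator {x. 0 < q \<and> x \<in> {A (real_of_rat q)..- B (real_of_rat q)}} x"
      by (auto simp: \<Phi>_def less_SUP_iff)
    then have "\<kappa> < real_of_rat q" "x \<in> {A (real_of_rat q)..- B (real_of_rat q)}"
      using that by (auto simp: indicator_def of_bool_def ennreal_less_iff simp del: of_rat_less_0_iff split: if_splits)
    moreover from this have "A \<kappa> \<le> A (real_of_rat q)" "B \<kappa> \<le> B (real_of_rat q)"
      using that by (auto intro!: mono_onD[OF A] mono_onD[OF B] simp del: zero_less_of_rat_iff)
    ultimately show ?thesis by auto
  qed
  have le_\<Phi>: "ennreal \<nu> \<le> \<Phi> x" if x: "x \<in> {A \<nu>..- B \<nu>}" and "0 < \<nu>" for \<nu> x
  proof (rule dense_le)
    fix z assume "z < ennreal \<nu>"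
    then obtain q :: rat where q: "z < ennreal (real_of_rat q)" "ennreal (real_of_rat q) < ennreal \<nu>"
      using ennreal_rat_dense by blast
    then have "0 < real_of_rat q" "real_of_rat q < \<nu>"
      by (metis ennreal_neg linorder_not_less not_less_zero)
        (metis q(2) ennreal_leI linorder_not_less)
    then have "A (real_of_rat q) \<le> A \<nu>" "B (real_of_rat q) \<le> B \<nu>" "0 < q"
      using mono_onD[OF A, of "real_of_rat q" \<nu>] mono_onD[OF B, of "real_of_rat q" \<nu>] \<open>0 < \<nu>\<close> by auto
    with x have "x \<in> {A (real_of_rat q)..- B (real_of_rat q)}" "0 < q"
      by auto
    then have "ennreal (real_of_rat q) \<le> \<Phi> x"
      unfolding \<Phi>_def by (intro SUP_upper2[of q]) auto
    with q show "z \<le> \<Phi> x" by auto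
  qed
  have level\<Phi>: "superlevel \<Phi> (ennreal \<nu>) = {A \<nu>..- B \<nu>}" if \<nu>: "0 < \<nu>" "\<nu> \<notin> D" for \<nu>
  proof (intro subset_antisym subsetI)
    fix x assume "x \<in> superlevel \<Phi> (ennreal \<nu>)"
    then have x: "ennreal \<nu> \<le> \<Phi> x"
      by (simp add: superlevel_def)
    have ev: "\<forall>\<^sub>F \<kappa> in at_left \<nu>. x \<in> {A \<kappa>..- B \<kappa>}"
    proof (rule eventually_at_leftI[of 0])
      fix \<kappa> assume \<kappa>: "\<kappa> \<in> {0<..<\<nu>}"
      then have "ennreal \<kappa> < \<Phi> x"
        by (intro less_le_trans[OF _ x]) (auto simp: ennreal_less_iff)
      then show "x \<in> {A \<kappa>..- B \<kappa>}"
        using \<Phi>_less[of \<kappa> x] \<kappa> by auto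
    qed (use \<nu> in auto)
    have cont: "(A \<longlongrightarrow> A \<nu>) (at_left \<nu>)" "(B \<longlongrightarrow> B \<nu>) (at_left \<nu>)"
      using \<nu> by (auto simp: D_def isCont_def intro: tendsto_mono[OF at_le])
    have "A \<nu> \<le> x"
      using cont(1) by (rule tendsto_upperbound) (use ev in \<open>auto elim: eventually_mono\<close>)
    moreover have "B \<nu> \<le> - x"
      using cont(2) by (rule tendsto_upperbound) (use ev in \<open>auto elim!: eventually_mono\<close>)
    ultimately show "x \<in> {A \<nu>..- B \<nu>}" by auto
  next
    fix x assume x: "x \<in> {A \<nu>..- B \<nu>}"
    \<comment> \<open>This places the limit interval in the half-line, to which
      \<open>superlevel\<close> is restricted.\<close>
    have "0 \<le> A \<nu>"
      by (rule LIMSEQ_le_const[OF lim\<alpha>[OF \<nu>]]) (use \<alpha>(1) \<nu> in auto)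
    with x le_\<Phi>[OF x \<nu>(1)] show "x \<in> superlevel \<Phi> (ennreal \<nu>)"
      by (auto simp: superlevel_def)
  qed
  \<comment> \<open>\<open>N\<close> lies in every limit interval. The lengths of these are at most
    \<open>m \<nu>\<close> outside \<open>D\<close>, so \<open>\<nu>\<close> is sent to infinity
    along levels avoiding \<open>D\<close>.\<close>
  have N: "emeasure lebesgue N = 0"
  proof -
    have "emeasure lebesgue N \<le> ennreal (m \<nu>)" if "0 < \<nu>" "\<nu> \<notin> D" for \<nu>
    proof -
      have "N \<subseteq> {A \<nu>..- B \<nu>}"
        using \<Phi>_less[OF that(1)] by (auto simp: N_def)
      then have "emeasure lebesgue N \<le> emeasure lebesgue {A \<nu>..- B \<nu>}"
        by (intro emeasure_mono) auto
      also have "\<dots> \<le> ennreal (- B \<nu> - A \<nu>)"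
        by (cases "A \<nu> \<le> - B \<nu>") auto
      also have "- B \<nu> \<le> A \<nu> + m \<nu>"
        by (rule LIMSEQ_le[OF lim\<beta>[OF that] tendsto_add[OF lim\<alpha>[OF that] tendsto_const]])
          (use \<beta>(2) that in auto)
      then have "ennreal (- B \<nu> - A \<nu>) \<le> ennreal (m \<nu>)"
        by (intro ennreal_leI) simp
      finally show ?thesis .
    qed
    note * = this
    \<comment> \<open>A nonempty open interval is uncountable and cannot be contained in
      \<open>D\<close>.\<close>
    have "\<exists>\<nu>\<ge>real n + 1. \<nu> \<notin> D" for n
    proof -
      have "uncountable {real n + 1<..<real n + 2}"
        by (simp add: uncountable_open_interval)
      then have "\<not> {real n + 1<..<real n + 2} \<subseteq> D"
        using D countable_subset by blast
      then obtain \<nu> where "\<nu> \<in> {real n + 1<..<real n + 2}" "\<nu> \<notin> D"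
        by blast
      then show ?thesis by (intro exI[of _ \<nu>]) simp
    qed
    then obtain \<nu> where \<nu>: "\<And>n. real n + 1 \<le> \<nu> n" "\<And>n. \<nu> n \<notin> D"
      by metis
    have "filterlim \<nu> at_top sequentially"
    proof (rule filterlim_at_top_mono[OF filterlim_real_sequentially])
      show "\<forall>\<^sub>F n in sequentially. real n \<le> \<nu> n"
        using \<nu>(1) by (auto intro!: always_eventually order_trans[OF _ \<nu>(1)])
    qed
    then have "(\<lambda>n. m (\<nu> n)) \<longlonglongrightarrow> 0"
      using m filterlim_compose by blast
    then have "(\<lambda>n. ennreal (m (\<nu> n))) \<longlonglongrightarrow> ennreal 0"
      by (rule tendsto_ennrealI)
    then have "emeasure lebesgue N \<le> ennreal 0"
    proof (rule LIMSEQ_le_const)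
      have "0 < \<nu> n" for n
        using \<nu>(1)[of n] by linarith
      then show "\<exists>N'. \<forall>n\<ge>N'. emeasure lebesgue N \<le> ennreal (m (\<nu> n))"
        using * \<nu>(2) by blast
    qed
    then show ?thesis by simp
  qed
  have Nset: "N \<in> sets lebesgue"
  proof -
    have "N \<in> sets borel"
      unfolding N_def using \<Phi> by measurable
    then show ?thesis by simp
  qed
  have "ennreal (\<psi> x) = \<Phi> x" if "x \<notin> N" for x
    using that by (simp add: \<psi>_def N_def less_top)
  then have level\<psi>: "sym_diff S (superlevel (\<lambda>x. ennreal (\<psi> x)) (ennreal \<nu>))
      \<subseteq> sym_diff S (superlevel \<Phi> (ennreal \<nu>)) \<union> N" for S \<nu>
    by (auto simp: superlevel_def)
  have main: "(\<lambda>n. emeasure lebesgue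
       (sym_diff (superlevel (T (r n)) (ennreal \<nu>)) (superlevel (\<lambda>x. ennreal (\<psi> x)) (ennreal \<nu>))))
       \<longlonglongrightarrow> 0" if \<nu>: "0 < \<nu>" "\<nu> \<notin> D" for \<nu>
  proof -
    define g where "g n = \<bar>\<alpha> (r n) \<nu> - A \<nu>\<bar> + \<bar>\<beta> (r n) \<nu> + B \<nu>\<bar>" for n
    have "(\<lambda>n. \<bar>\<alpha> (r n) \<nu> - A \<nu>\<bar> + \<bar>\<beta> (r n) \<nu> - (- B \<nu>)\<bar>) \<longlonglongrightarrow> \<bar>A \<nu> - A \<nu>\<bar> + \<bar>- B \<nu> - (- B \<nu>)\<bar>"
      by (intro tendsto_intros lim\<alpha> lim\<beta> \<nu>)
    then have "g \<longlonglongrightarrow> 0"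
      by (simp add: g_def[abs_def])
    then have g: "(\<lambda>n. ennreal (g n)) \<longlonglongrightarrow> 0"
      using tendsto_ennrealI by fastforce
    have le: "emeasure lebesgue (sym_diff (superlevel (T (r n)) (ennreal \<nu>))
        (superlevel (\<lambda>x. ennreal (\<psi> x)) (ennreal \<nu>))) \<le> ennreal (g n)" for n
    proof -
      \<comment> \<open>The gaps between corresponding endpoints cover the symmetric difference of
        the two intervals, even if one of them is empty.\<close>
      define I where "I = {min (\<alpha> (r n) \<nu>) (A \<nu>)..max (\<alpha> (r n) \<nu>) (A \<nu>)}"
      define J where "J = {min (\<beta> (r n) \<nu>) (- B \<nu>)..max (\<beta> (r n) \<nu>) (- B \<nu>)}"
      have "sym_diff (superlevel (T (r n)) (ennreal \<nu>)) (superlevel (\<lambda>x. ennreal (\<psi> x)) (ennreal \<nu>))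
          \<subseteq> sym_diff {\<alpha> (r n) \<nu>..\<beta> (r n) \<nu>} {A \<nu>..- B \<nu>} \<union> N"
        using level\<psi>[of "superlevel (T (r n)) (ennreal \<nu>)" \<nu>] level[OF \<nu>(1)] level\<Phi>[OF \<nu>] by simp
      also have "\<dots> \<subseteq> (I \<union> J) \<union> N"
        by (auto simp: I_def J_def)
      finally have "emeasure lebesgue (sym_diff (superlevel (T (r n)) (ennreal \<nu>))
          (superlevel (\<lambda>x. ennreal (\<psi> x)) (ennreal \<nu>))) \<le> emeasure lebesgue ((I \<union> J) \<union> N)"
        using Nset by (intro emeasure_mono) (auto simp: I_def J_def)
      also have "\<dots> = emeasure lebesgue (I \<union> J)"
        using N Nset by (intro emeasure_Un_null_set) (auto simp: I_def J_def)
      also have "\<dots> \<le> emeasure lebesgue I + emeasure lebesgue J"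
        by (intro emeasure_subadditive) (auto simp: I_def J_def)
      also have "\<dots> = ennreal (g n)"
        by (simp add: I_def J_def g_def max_def min_def abs_if flip: ennreal_plus)
      finally show ?thesis .
    qed
    show ?thesis
      by (rule tendsto_sandwich[OF _ _ tendsto_const g]) (use le in auto)
  qed
  show thesis
  proof (rule that[of \<psi> r])
    show "\<psi> \<in> borel_measurable borel"
      unfolding \<psi>_def using \<Phi> by measurable
    have "AE \<nu> in lebesgue. \<nu> \<notin> D"
      using countable_imp_null_set_lborel[OF D] by (intro AE_completion AE_not_in)
    then have "AE \<nu> in lebesgue_on {0<..}. 0 < \<nu> \<and> \<nu> \<notin> D"
      by (subst AE_restrict_space_iff) auto
    then show "AE \<nu> in lebesgue_on {0<..}. (\<lambda>n. emeasure lebesgue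
       (sym_diff (superlevel (T (r n)) (ennreal \<nu>)) (superlevel (\<lambda>x. ennreal (\<psi> x)) (ennreal \<nu>))))
       \<longlonglongrightarrow> 0"
      by eventually_elim (use main in blast)
  qed (use r in \<open>auto simp: \<psi>_def\<close>)
qed

section \<open>Chebyshev's inequality\<close>

text \<open>Markov's inequality for \<open>\<bar>f x\<bar> powr p\<close> at the threshold
  \<open>\<nu> powr p\<close>. Since \<open>\<nu> > 0\<close>, a point of the superlevel set
  satisfies \<open>\<nu> \<le> f x\<close> in the reals.\<close>

lemma in_Lp_emeasure_superlevel_le:
  assumes p: "0 < p" and f: "in_Lp p f" and C: "Lp_norm p f \<le> C" and \<nu>: "0 < \<nu>"
  shows "emeasure lebesgue (superlevel (\<lambda>x. ennreal (f x)) (ennreal \<nu>)) \<le> ennreal ((C / \<nu>) powr p)"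
proof -
  let ?M = "lebesgue_on {0..}" and ?u = "\<lambda>x. \<bar>f x\<bar> powr p"
  let ?I = "integral\<^sup>L ?M ?u"
  have f': "f \<in> borel_measurable ?M" and int: "integrable ?M ?u"
    using f by (auto simp: in_Lp_def)
  have I: "0 \<le> ?I"
    by (intro integral_nonneg_AE) auto
  have "0 \<le> C"
    using C unfolding Lp_norm_def by (rule order_trans[rotated]) simp
  have "?I = Lp_norm p f powr p"
    using I p by (simp add: Lp_norm_def powr_powr)
  also have "\<dots> \<le> C powr p"
    using C p by (intro powr_mono2) (auto simp: Lp_norm_def)
  finally have IC: "?I \<le> C powr p" .
  have S: "superlevel (\<lambda>x. ennreal (f x)) (ennreal \<nu>) \<subseteq> {x \<in> space ?M. \<nu> powr p \<le> ?u x}"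
    using \<nu> p by (auto simp: superlevel_def ennreal_le_iff2 intro!: powr_mono2)
  have meas: "{x \<in> space ?M. \<nu> powr p \<le> ?u x} \<in> sets ?M"
    using f' by measurable
  have sets_lebesgue_on_iff: "S \<in> sets ?M \<longleftrightarrow> S \<subseteq> {0..} \<and> S \<in> sets lebesgue" for S :: "real set"
    by (rule sets_restrict_space_iff) simp
  have "emeasure lebesgue (superlevel (\<lambda>x. ennreal (f x)) (ennreal \<nu>))
      \<le> emeasure lebesgue {x \<in> space ?M. \<nu> powr p \<le> ?u x}"
    using meas by (intro emeasure_mono[OF S]) (simp only: sets_lebesgue_on_iff)
  also have "\<dots> = emeasure ?M {x \<in> space ?M. \<nu> powr p \<le> ?u x}"
    by (rule emeasure_restrict_space[symmetric]) auto
  also have "\<dots> \<le> ennreal (1 / (\<nu> powr p) * ?I)"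
    using int \<nu> by (intro integral_Markov_inequality) auto
  also have "\<dots> \<le> ennreal ((C / \<nu>) powr p)"
    using IC \<nu> \<open>0 \<le> C\<close> by (intro ennreal_leI) (auto simp: powr_divide divide_simps)
  finally show ?thesis .
qed

section \<open>Subsequences of tampings of a bounded sequence\<close>

theorem lemma3p6:
  fixes p :: real and \<phi> :: "nat \<Rightarrow> real \<Rightarrow> real"
  assumes "1 \<le> p"
    and "\<And>n. in_Lp p (\<phi> n)"
    and "\<exists>C. \<forall>n. Lp_norm p (\<phi> n) \<le> C"
    and "\<And>n. AE x in lebesgue_on {0..}. 0 \<le> \<phi> n x"
    and "\<exists>\<mu>::real. 0 < \<mu> \<and>
           limsup (\<lambda>n. x_level (ennreal \<mu>) (\<lambda>x. ennreal (\<phi> n x))) < \<infinity>"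
  shows "\<exists>\<psi> :: real \<Rightarrow> real.
           \<psi> \<in> borel_measurable (lebesgue_on {0..}) \<and> (\<forall>x\<ge>0. 0 \<le> \<psi> x) \<and>
           (\<exists>r :: nat \<Rightarrow> nat. strict_mono r \<and>
             (AE \<nu> in lebesgue_on {0<..}.
               (\<lambda>n. emeasure lebesgue
                      (sym_diff (superlevel (tamping (\<lambda>x. ennreal (\<phi> (r n) x))) (ennreal \<nu>))
                                (superlevel (\<lambda>x. ennreal (\<psi> x)) (ennreal \<nu>))))
               \<longlonglongrightarrow> 0))"
proof -
  obtain C where C: "\<And>n. Lp_norm p (\<phi> n) \<le> C"
    using assms(3) by blast
  obtain \<mu> :: real where \<mu>: "0 < \<mu>" "limsup (\<lambda>n. x_level (ennreal \<mu>) (\<lambda>x. ennreal (\<phi> n x))) < \<infinity>"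
    using assms(5) by blast
  define m where "m \<nu> = (C / \<nu>) powr p" for \<nu>
  \<comment> \<open>A finite value strictly above the limsup bounds all but finitely many
    terms.\<close>
  obtain l where l: "limsup (\<lambda>n. x_level (ennreal \<mu>) (\<lambda>x. ennreal (\<phi> n x))) < l" "l < \<infinity>"
    using dense[OF \<mu>(2)] by blast
  then obtain R where R: "l = ennreal R" "0 \<le> R"
    by (cases l) auto
  have "\<forall>\<^sub>F n in sequentially. x_level (ennreal \<mu>) (\<lambda>x. ennreal (\<phi> n x)) < l"
    using l(1) by (rule Limsup_lessD)
  then obtain N where N: "\<And>n. N \<le> n \<Longrightarrow> x_level (ennreal \<mu>) (\<lambda>x. ennreal (\<phi> n x)) \<le> ennreal R"
    unfolding eventually_sequentially R by (auto intro: less_imp_le)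
  \<comment> \<open>Dropping the first \<open>N\<close> terms makes the bound \<open>R\<close>
    uniform; the final extraction is therefore \<open>r n + N\<close>.\<close>
  define f where "f n x = ennreal (\<phi> (n + N) x)" for n x
  have "\<exists>\<alpha> \<beta>. mono_on {0<..} \<alpha> \<and> antimono_on {0<..} \<beta> \<and>
    (\<forall>\<nu>>0. superlevel (tamping (f n)) (ennreal \<nu>) = {\<alpha> \<nu>..\<beta> \<nu>} \<and> 0 \<le> \<alpha> \<nu> \<and>
      \<alpha> \<nu> \<le> R + m \<mu> + 1 \<and> 0 \<le> \<beta> \<nu> \<and> \<beta> \<nu> \<le> \<alpha> \<nu> + m (\<nu> / 2))" for n
  proof -
    have "\<phi> (n + N) \<in> borel_measurable (lebesgue_on {0..})"
      using assms(2)[of "n + N"] by (simp add: in_Lp_def)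
    then have 1: "f n \<in> borel_measurable (lebesgue_on {0..})"
      unfolding f_def[abs_def] by measurable
    have 2: "emeasure lebesgue (superlevel (f n) (ennreal \<nu>)) \<le> ennreal (m \<nu>)" if "0 < \<nu>" for \<nu>
      unfolding f_def m_def using assms(1,2) C that by (intro in_Lp_emeasure_superlevel_le) auto
    have 3: "0 \<le> m \<nu>" for \<nu>
      by (simp add: m_def)
    have 4: "x_level (ennreal \<mu>) (f n) \<le> ennreal R"
      using N[of "n + N"] by (simp add: f_def[abs_def])
    show ?thesis
      by (rule tamping_levels_are_intervals[OF 1 2 3 \<mu>(1) 4 R(2)]) blast+
  qed
  then obtain \<alpha> \<beta> where \<alpha>\<beta>: "\<And>n. mono_on {0<..} (\<alpha> n)" "\<And>n. antimono_on {0<..} (\<beta> n)"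
    "\<And>n \<nu>. 0 < \<nu> \<Longrightarrow> superlevel (tamping (f n)) (ennreal \<nu>) = {\<alpha> n \<nu>..\<beta> n \<nu>} \<and> 0 \<le> \<alpha> n \<nu> \<and>
      \<alpha> n \<nu> \<le> R + m \<mu> + 1 \<and> 0 \<le> \<beta> n \<nu> \<and> \<beta> n \<nu> \<le> \<alpha> n \<nu> + m (\<nu> / 2)"
    by metis
  \<comment> \<open>\<open>m (\<nu> / 2)\<close> equals \<open>(2 * C / \<nu>) powr p\<close>, so
    the interval lengths vanish as the level grows.\<close>
  have "((\<lambda>\<nu>. (2 * C) / \<nu>) \<longlongrightarrow> 0) at_top"
    by (intro tendsto_divide_0[OF tendsto_const] filterlim_at_top_imp_at_infinity filterlim_ident)
  then have "((\<lambda>\<nu>. ((2 * C) / \<nu>) powr p) \<longlongrightarrow> 0 powr p) at_top"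
  proof (rule tendsto_powr2)
    have "0 \<le> C"
      using C[of 0] unfolding Lp_norm_def by (rule order_trans[rotated]) simp
    then show "\<forall>\<^sub>F \<nu> in at_top. 0 \<le> 2 * C / \<nu>"
      by (intro eventually_mono[OF eventually_gt_at_top[of 0]]) simp
  qed (use assms(1) in auto)
  then have m: "((\<lambda>\<nu>. m (\<nu> / 2)) \<longlongrightarrow> 0) at_top"
    by (simp add: m_def mult.commute)
  obtain \<psi> r where \<psi>: "\<psi> \<in> borel_measurable borel" "\<And>x. 0 \<le> \<psi> x"
    and r: "strict_mono (r :: nat \<Rightarrow> nat)"
    and lim: "AE \<nu> in lebesgue_on {0<..}. (\<lambda>n. emeasure lebesgue
       (sym_diff (superlevel (tamping (f (r n))) (ennreal \<nu>)) (superlevel (\<lambda>x. ennreal (\<psi> x)) (ennreal \<nu>))))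
       \<longlonglongrightarrow> 0"
    by (rule interval_superlevels_subsequence[of \<alpha> \<beta> "\<lambda>n. tamping (f n)" "R + m \<mu> + 1" "\<lambda>\<nu>. m (\<nu> / 2)"])
      (use \<alpha>\<beta> m in auto)
  show ?thesis
  proof (intro exI[of _ \<psi>] exI[of _ "\<lambda>n. r n + N"] conjI)
    show "\<psi> \<in> borel_measurable (lebesgue_on {0..})"
      using \<psi>(1) by (simp add: measurable_completion measurable_restrict_space1)
    show "\<forall>x\<ge>0. 0 \<le> \<psi> x"
      using \<psi>(2) by blast
    show "strict_mono (\<lambda>n. r n + N)"
      using r by (simp add: strict_mono_def)
    show "AE \<nu> in lebesgue_on {0<..}. (\<lambda>n. emeasure lebesgue
       (sym_diff (superlevel (tamping (\<lambda>x. ennreal (\<phi> (r n + N) x))) (ennreal \<nu>))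
         (superlevel (\<lambda>x. ennreal (\<psi> x)) (ennreal \<nu>)))) \<longlonglongrightarrow> 0"
      using lim by (simp add: f_def[abs_def])
  qed
qed

end
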